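(* Let $H$ be the graph obtained from $K_4$ by subdividing one edge, and let $G^*$ be the graph obtained from three disjoint copies of $H$ by adding one new vertex $v$ adjacent to the three vertices of degree $2$ in these copies. Then $G^*$ is $(7,2)$-edge-choosable.
   Context: A graph is $(r,s)$-edge-choosable if for every assignment of lists of size $r$ to its edges, one can choose $s$ colors from each edge's list so that incident edges receive disjoint sets. *)

theory Defs
  imports Main
begin

text \<open>A simple graph is a pair of a vertex set and a set of two-element subsets of it.\<close>

type_synonym 'a graph = "'a set \<times> 'a set set"

abbreviation verts :: "'a graph \<Rightarrow> 'a set" where
  "verts G \<equiv> fst G"

abbreviation edges :: "'a graph \<Rightarrow> 'a set set" where
  "edges G \<equiv> snd G"

definition simple_graph :: "'a graph \<Rightarrow> bool" where
  "simple_graph G \<longleftrightarrow> finite (verts G) \<and> (\<forall>e\<in>edges G. e \<subseteq> verts G \<and> card e = 2)"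

definition degree :: "'a graph \<Rightarrow> 'a \<Rightarrow> nat" where
  "degree G x = card {e \<in> edges G. x \<in> e}"

definition complete_graph :: "'a set \<Rightarrow> 'a graph" where
  "complete_graph V = (V, {e. e \<subseteq> V \<and> card e = 2})"

definition subdivide_edge :: "'a graph \<Rightarrow> 'a set \<Rightarrow> 'a \<Rightarrow> 'a graph" where
  "subdivide_edge G e w = (insert w (verts G), (edges G - {e}) \<union> {{u, w} | u. u \<in> e})"

text \<open>The first argument only fixes the type of colors. A statement about
  \<^term>\<open>edge_choosable TYPE('c)\<close> with \<open>'c\<close> a type variable covers lists of colors of every type.\<close>

definition edge_choosable :: "'c itself \<Rightarrow> nat \<Rightarrow> nat \<Rightarrow> 'a graph \<Rightarrow> bool" where
  "edge_choosable C r s G \<longleftrightarrow>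
     (\<forall>L :: 'a set \<Rightarrow> 'c set.
        (\<forall>e\<in>edges G. finite (L e) \<and> card (L e) = r) \<longrightarrow>
        (\<exists>\<phi> :: 'a set \<Rightarrow> 'c set.
           (\<forall>e\<in>edges G. \<phi> e \<subseteq> L e \<and> card (\<phi> e) = s) \<and>
           (\<forall>e\<in>edges G. \<forall>f\<in>edges G. e \<noteq> f \<and> e \<inter> f \<noteq> {} \<longrightarrow> \<phi> e \<inter> \<phi> f = {})))"

definition H :: "nat graph" where
  "H = subdivide_edge (complete_graph {0, 1, 2, 3}) {0, 1} 4"

text \<open>The vertex \<open>Some (i, x)\<close> is the vertex \<open>x\<close> of the \<open>i\<close>-th copy of \<^const>\<open>H\<close>; the vertex
  \<open>None\<close> is the added vertex \<open>v\<close>.\<close>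

definition Gstar :: "(nat \<times> nat) option graph" where
  "Gstar =
     (insert None {Some (i, x) | i x. i < 3 \<and> x \<in> verts H},
      {(\<lambda>x. Some (i, x)) ` e | i e. i < 3 \<and> e \<in> edges H} \<union>
      {{None, Some (i, x)} | i x. i < 3 \<and> x \<in> verts H \<and> degree H x = 2})"

lemma verts_H: "verts H = {0, 1, 2, 3, 4}"
  by (auto simp: H_def subdivide_edge_def complete_graph_def)

lemma edges_H: "edges H = {{0, 2}, {0, 3}, {1, 2}, {1, 3}, {2, 3}, {0, 4}, {1, 4}}"
proof -
  have "{e. e \<subseteq> {0, 1, 2, 3::nat} \<and> card e = 2} =
        {{0, 1}, {0, 2}, {0, 3}, {1, 2}, {1, 3}, {2, 3}}" (is "?A = ?B")
  proof (rule set_eqI, rule iffI)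
    fix e assume "e \<in> ?A"
    then obtain x y where xy: "e = {x, y}" "x \<noteq> y"
      by (auto simp: card_2_iff)
    with \<open>e \<in> ?A\<close> have "x \<in> {0, 1, 2, 3}" "y \<in> {0, 1, 2, 3}"
      by blast+
    with xy show "e \<in> ?B"
      by (elim insertE emptyE; simp add: insert_commute)
  qed auto
  moreover have "{{u, 4} | u. u \<in> {0, 1::nat}} = {{0, 4}, {1, 4}}"
    by blast
  ultimately show ?thesis
    unfolding H_def subdivide_edge_def complete_graph_def
    by (simp add: insert_Diff_if doubleton_eq_iff insert_commute)
qed

lemma degree_H_eq_2_iff:
  assumes "x \<in> verts H"
  shows "degree H x = 2 \<longleftrightarrow> x = 4"
proof -
  have "{e \<in> edges H. 0 \<in> e} = {{0, 2}, {0, 3}, {0, 4}}"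
    "{e \<in> edges H. 1 \<in> e} = {{1, 2}, {1, 3}, {1, 4}}"
    "{e \<in> edges H. 2 \<in> e} = {{0, 2}, {1, 2}, {2, 3}}"
    "{e \<in> edges H. 3 \<in> e} = {{0, 3}, {1, 3}, {2, 3}}"
    "{e \<in> edges H. 4 \<in> e} = {{0, 4}, {1, 4}}"
    unfolding edges_H by (simp_all add: Collect_disj_eq conj_disj_distribR Collect_conv_if
      insert_Collect[symmetric] insert_commute)
  then have "degree H 0 = 3" "degree H 1 = 3" "degree H 2 = 3" "degree H 3 = 3" "degree H 4 = 2"
    unfolding degree_def by (simp_all add: doubleton_eq_iff)
  with assms show ?thesis
    unfolding verts_H by (elim insertE emptyE) simp_all
qed

lemma simple_graph_H: "simple_graph H"
  by (simp add: simple_graph_def verts_H edges_H)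

lemma simple_graph_Gstar: "simple_graph Gstar"
proof -
  have "{Some (i, x) | i x. i < (3::nat) \<and> x \<in> verts H} = Some ` ({..<3} \<times> verts H)"
    by auto
  then have "finite (verts Gstar)"
    using simple_graph_H by (simp add: Gstar_def simple_graph_def)
  moreover have "card ((\<lambda>x. Some (i, x)) ` e) = card e" for i :: nat and e :: "nat set"
    by (rule card_image) (auto simp: inj_on_def)
  ultimately show ?thesis
    using simple_graph_H by (auto simp: simple_graph_def Gstar_def) blast
qed

end

theory Submission
  imports Defs
begin

text \<open>
  First choose disjoint pairs of colors for the three edges at \<open>v\<close>. In each copy of \<^const>\<open>H\<close>
  the two edges \<open>p\<close>, \<open>q\<close> at the vertex of degree 2 then keep at least 5 colors, and all other
  lists are untouched. Removing \<open>p\<close>, \<open>q\<close> and the edge \<open>f\<close> opposite to them leaves a 4-cycle, each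
  edge of which is incident to \<open>f\<close> and to exactly one of \<open>p\<close>, \<open>q\<close>. One can color \<open>f\<close>, \<open>p\<close>, \<open>q\<close> so
  that every edge of the 4-cycle loses at most 3 colors, by letting \<open>f\<close> share a color with \<open>p\<close> and
  with \<open>q\<close> when the lists meet, and by using colors outside the lists of the cycle edges when they
  do not. The remaining lists of size 4 suffice because a 4-cycle is \<open>(2m,m)\<close>-choosable.
\<close>

section \<open>Cardinality estimates and set colorings of the 4-cycle\<close>

lemma card_ge_finite:
  assumes "k \<le> card A" "0 < k"
  shows "finite A"
  using assms by (metis card.infinite not_le)

lemma obtain_subset_card_ge:
  assumes "n \<le> card A"
  obtains B where "B \<subseteq> A" "card B = n" "finite B"
  using obtain_subset_with_card_n[OF assms] by metis

lemma four_mult_le_square: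
  fixes i j k :: nat
  assumes "i + j \<le> k"
  shows "4 * (i * j) \<le> k * k"
proof -
  have "0 \<le> (int i - int j) * (int i - int j)"
    by simp
  then have "4 * (int i * int j) \<le> (int i + int j) * (int i + int j)"
    by (simp add: algebra_simps)
  then have "4 * (i * j) \<le> (i + j) * (i + j)"
    by (metis (no_types, lifting) of_nat_add of_nat_le_iff of_nat_mult of_nat_numeral)
  also have "\<dots> \<le> k * k"
    using assms by (simp add: mult_le_mono)
  finally show ?thesis .
qed

lemma card_Diff_pair_ge:
  assumes "finite B" "\<not> {x, y} \<subseteq> B \<or> x = y"
  shows "card B - 1 \<le> card (B - {x, y})"
proof -
  have "card (B \<inter> {x, y}) \<le> 1"
    using assms by (cases "x \<in> B"; cases "y \<in> B") auto
  moreover have "card (B - {x, y}) = card B - card (B \<inter> {x, y})"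
    using assms by (simp add: card_Diff_subset_Int)
  ultimately show ?thesis
    by linarith
qed

text \<open>\<open>A\<close>, \<open>D\<close> and \<open>B\<close>, \<open>C\<close> are the lists
  on the two pairs of opposite edges of a 4-cycle. A color common to \<open>A\<close> and
  \<open>D\<close> can serve as both \<open>x\<close> and \<open>y\<close>. Otherwise, with all
  lists cut to \<open>k + 1\<close> colors, counting shows that at most half of the pairs
  \<open>(x, y)\<close> take two colors from the same one of the lists cut from \<open>B\<close> and
  \<open>C\<close>.\<close>

lemma opposite_colors:
  assumes "Suc k \<le> card A" "Suc k \<le> card B" "Suc k \<le> card C" "Suc k \<le> card D"
  shows "\<exists>x\<in>A. \<exists>y\<in>D. k \<le> card (B - {x, y}) \<and> k \<le> card (C - {x, y})"
proof -
  obtain A' B' C' D' where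
    A: "A' \<subseteq> A" "card A' = Suc k" "finite A'" and
    B: "B' \<subseteq> B" "card B' = Suc k" "finite B'" and
    C: "C' \<subseteq> C" "card C' = Suc k" "finite C'" and
    D: "D' \<subseteq> D" "card D' = Suc k" "finite D'"
    using assms by (meson obtain_subset_card_ge)
  have "\<exists>x\<in>A'. \<exists>y\<in>D'. (\<not> {x, y} \<subseteq> B' \<or> x = y) \<and> (\<not> {x, y} \<subseteq> C' \<or> x = y)"
  proof (cases "A' \<inter> D' = {}")
    case True
    \<comment> \<open>As \<open>A'\<close> and \<open>D'\<close> are disjoint, their traces on
      \<open>X\<close> have total size at most \<open>k + 1\<close>, so by the AM-GM inequality at
      most a quarter of all pairs lie inside \<open>X\<close>.\<close>
    have bound: "4 * card ((A' \<inter> X) \<times> (D' \<inter> X)) \<le> Suc k * Suc k"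
      if "card X = Suc k" "finite X" for X
    proof -
      have "card (A' \<inter> X) + card (D' \<inter> X) = card ((A' \<inter> X) \<union> (D' \<inter> X))"
        using True that by (intro card_Un_disjoint[symmetric]) auto
      also have "\<dots> \<le> Suc k"
        using that by (metis card_mono Int_lower2 Un_least)
      finally show ?thesis
        using four_mult_le_square by (simp add: card_cartesian_product del: mult_Suc mult_Suc_right)
    qed
    let ?bad = "(A' \<inter> B') \<times> (D' \<inter> B') \<union> (A' \<inter> C') \<times> (D' \<inter> C')"
    have "4 * card ?bad \<le> 2 * (Suc k * Suc k)"
      using card_Un_le[of "(A' \<inter> B') \<times> (D' \<inter> B')" "(A' \<inter> C') \<times> (D' \<inter> C')"]
        bound[OF B(2,3)] bound[OF C(2,3)] by linarith
    moreover have "card (A' \<times> D') = Suc k * Suc k"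
      using A D by (simp add: card_cartesian_product)
    ultimately have "card ?bad < card (A' \<times> D')"
      by simp
    then have "\<not> A' \<times> D' \<subseteq> ?bad"
      using A B D by (metis card_mono finite_Un finite_Int finite_SigmaI not_le)
    then show ?thesis
      by blast
  qed blast
  then obtain x y where xy: "x \<in> A'" "y \<in> D'"
    "\<not> {x, y} \<subseteq> B' \<or> x = y" "\<not> {x, y} \<subseteq> C' \<or> x = y"
    by blast
  have "finite B" "finite C"
    using assms card_ge_finite by blast+
  then have "card (B' - {x, y}) \<le> card (B - {x, y})" "card (C' - {x, y}) \<le> card (C - {x, y})"
    using B C by (auto intro!: card_mono)
  then have "k \<le> card (B - {x, y}) \<and> k \<le> card (C - {x, y})"
    using card_Diff_pair_ge[OF B(3) xy(3)] card_Diff_pair_ge[OF C(3) xy(4)] B C by simp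
  then show ?thesis
    using xy A D by blast
qed

text \<open>Induction on \<open>j\<close>: a round of \<open>opposite_colors\<close> deletes
  \<open>x\<close> from \<open>A\<close>, \<open>y\<close> from \<open>D\<close> and both from
  \<open>B\<close> and \<open>C\<close>, and the required size of all four lists drops by just
  one.\<close>

lemma opposite_color_sets:
  assumes "m + j \<le> card A" "m + j \<le> card B" "m + j \<le> card C" "m + j \<le> card D"
  shows "\<exists>X Y. X \<subseteq> A \<and> card X = j \<and> finite X \<and> Y \<subseteq> D \<and> card Y = j \<and> finite Y \<and>
           m \<le> card (B - (X \<union> Y)) \<and> m \<le> card (C - (X \<union> Y))"
  using assms
proof (induction j arbitrary: A B C D)
  case 0
  then show ?case
    by (intro exI[of _ "{}"]) simp
next
  case (Suc j)
  then obtain x y where xy: "x \<in> A" "y \<in> D"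
    "m + j \<le> card (B - {x, y})" "m + j \<le> card (C - {x, y})"
    using opposite_colors[of "m + j" A B C D] by auto
  have "finite A" "finite D"
    using Suc.prems card_ge_finite by (metis add_Suc_right zero_less_Suc)+
  then have "m + j \<le> card (A - {x})" "m + j \<le> card (D - {y})"
    using xy Suc.prems by simp_all
  from Suc.IH[OF this(1) xy(3,4) this(2)] obtain X Y where XY:
    "X \<subseteq> A - {x}" "card X = j" "finite X" "Y \<subseteq> D - {y}" "card Y = j" "finite Y"
    "m \<le> card (B - {x, y} - (X \<union> Y))" "m \<le> card (C - {x, y} - (X \<union> Y))"
    by blast
  moreover have "S - {x, y} - (X \<union> Y) = S - (insert x X \<union> insert y Y)" for S
    by blast
  moreover have "x \<notin> X" "y \<notin> Y"
    using XY by blast+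
  ultimately show ?case
    using xy by (intro exI[of _ "insert x X"] exI[of _ "insert y Y"]) auto
qed

text \<open>\<open>opposite_color_sets\<close> with \<open>j = m\<close> colors one pair of opposite
  edges. The other two edges, with lists \<open>B\<close> and \<open>C\<close>, share no vertex and
  pick independently from what is left.\<close>

lemma four_cycle_choosable:
  assumes "2 * m \<le> card A" "2 * m \<le> card B" "2 * m \<le> card C" "2 * m \<le> card D"
  obtains A' B' C' D' where
    "A' \<subseteq> A" "B' \<subseteq> B" "C' \<subseteq> C" "D' \<subseteq> D"
    "card A' = m" "card B' = m" "card C' = m" "card D' = m"
    "A' \<inter> B' = {}" "A' \<inter> C' = {}" "B' \<inter> D' = {}" "C' \<inter> D' = {}"
proof -
  obtain X Y where XY: "X \<subseteq> A" "card X = m" "Y \<subseteq> D" "card Y = m"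
    "m \<le> card (B - (X \<union> Y))" "m \<le> card (C - (X \<union> Y))"
    using opposite_color_sets[of m m A B C D] assms by (auto simp: mult_2)
  obtain B' C' where "B' \<subseteq> B - (X \<union> Y)" "card B' = m" "C' \<subseteq> C - (X \<union> Y)" "card C' = m"
    using XY(5,6) by (meson obtain_subset_card_ge)
  with XY show ?thesis
    by (intro that[of X B' C' Y]) auto
qed

section \<open>Choosing pairs of colors for f, p and q\<close>

text \<open>Two elements suffice to witness that \<open>S\<close> leaves both \<open>X\<close> and
  \<open>Y\<close>: one outside each. Hence one pair can deal with two cycle edges at once.\<close>

lemma obtain_pair_avoiding:
  assumes "2 \<le> card S"
  obtains P where "P \<subseteq> S" "card P = 2" "S \<subseteq> X \<or> \<not> P \<subseteq> X" "S \<subseteq> Y \<or> \<not> P \<subseteq> Y"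
proof -
  have pair: "\<exists>P. P \<subseteq> S \<and> card P = 2 \<and> x \<in> P \<and> y \<in> P" if "x \<in> S" "y \<in> S" for x y
  proof -
    have "\<exists>z\<in>S. z \<noteq> x"
    proof (rule ccontr)
      assume "\<not> (\<exists>z\<in>S. z \<noteq> x)"
      then have "S \<subseteq> {x}"
        by blast
      then have "card S \<le> card {x}"
        by (rule card_mono[rotated]) simp
      with assms show False
        by simp
    qed
    then obtain z where "z \<in> S" "z \<noteq> x"
      by blast
    with that show ?thesis
      by (intro exI[of _ "if x = y then {x, z} else {x, y}"]) auto
  qed
  obtain s where "s \<in> S"
    using assms by fastforce
  \<comment> \<open>If \<open>S\<close> lies inside \<open>X\<close>, there is nothing to escape and
    the arbitrary \<open>s\<close> is the default. The two witnesses may coincide, a case that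
    \<open>pair\<close> covers.\<close>
  define x where "x = (if S \<subseteq> X then s else SOME x. x \<in> S - X)"
  define y where "y = (if S \<subseteq> Y then s else SOME y. y \<in> S - Y)"
  have "x \<in> S" "S \<subseteq> X \<or> x \<notin> X" "y \<in> S" "S \<subseteq> Y \<or> y \<notin> Y"
    using \<open>s \<in> S\<close> someI_ex[of "\<lambda>x. x \<in> S - X"] someI_ex[of "\<lambda>y. y \<in> S - Y"]
    unfolding x_def y_def by auto
  with pair[of x y] show ?thesis
    using that by blast
qed

lemma card_Diff_ge:
  assumes "n + card B \<le> card A" "finite B"
  shows "n \<le> card (A - B)"
  using diff_card_le_card_Diff[OF assms(2), of A] assms(1) by linarith

lemma obtain_in_Diff:
  assumes "card B < card A" "finite B"
  obtains x where "x \<in> A" "x \<notin> B"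
  using assms by (meson card_mono not_le subsetI)

lemma card_Int_le_of_subset:
  assumes "finite A" "S \<subseteq> A" "S \<inter> F = {}"
  shows "card (A \<inter> F) \<le> card A - card S"
proof -
  have "card (A \<inter> F) \<le> card (A - S)"
    using assms by (intro card_mono) auto
  also have "\<dots> = card A - card S"
    using assms by (meson card_Diff_subset finite_subset)
  finally show ?thesis .
qed

text \<open>If \<open>F\<close> and \<open>P\<close> meet, their union has at most 3 elements; if
  they are disjoint, one of their four colors lies outside \<open>S\<close>. Either way
  \<open>S\<close> loses at most 3 of its 7 colors.\<close>

lemma card_Diff_two_pairs_ge:
  assumes "card S = 7" "card F = 2" "card P = 2" "F \<inter> P \<noteq> {} \<or> \<not> F \<subseteq> S \<or> \<not> P \<subseteq> S"
  shows "4 \<le> card (S - (F \<union> P))"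
proof -
  have fin: "finite F" "finite P"
    using assms by (auto intro: card_ge_finite)
  have FP: "card (F \<union> P) + card (F \<inter> P) = 4"
    using card_Un_Int[OF fin] assms by simp
  have "card (S \<inter> (F \<union> P)) \<le> 3"
  proof (cases "F \<inter> P = {}")
    case True
    then have "S \<inter> (F \<union> P) \<subset> F \<union> P"
      using assms by blast
    then have "card (S \<inter> (F \<union> P)) < card (F \<union> P)"
      using fin by (intro psubset_card_mono) auto
    then show ?thesis
      using FP by simp
  next
    case False
    then have "card (F \<inter> P) \<noteq> 0"
      using fin by simp
    moreover have "card (S \<inter> (F \<union> P)) \<le> card (F \<union> P)"
      using fin by (intro card_mono) auto
    ultimately show ?thesis
      using FP by simp
  qed
  then have "4 + card (S \<inter> (F \<union> P)) \<le> card S"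
    using assms by simp
  then have "4 \<le> card (S - (S \<inter> (F \<union> P)))"
    using fin by (intro card_Diff_ge) auto
  then show ?thesis
    by (simp add: Diff_Int_distrib Diff_Int)
qed

text \<open>In the next four lemmas \<open>F\<close>, \<open>P\<close>, \<open>Q\<close> are lists for \<open>f\<close>, \<open>p\<close>, \<open>q\<close>; the lists \<open>A\<close>, \<open>B\<close>
  belong to the cycle edges incident to \<open>p\<close>, and \<open>C\<close>, \<open>D\<close> to those incident to \<open>q\<close>.\<close>

lemma spokes_two_shared_colors:
  assumes "x \<in> F" "x \<in> P" "y \<in> F" "y \<in> Q" "x \<noteq> y" "5 \<le> card P" "5 \<le> card Q"
  shows "\<exists>F' P' Q'. F' \<subseteq> F \<and> P' \<subseteq> P \<and> Q' \<subseteq> Q \<and> card F' = 2 \<and> card P' = 2 \<and> card Q' = 2 \<and>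
           P' \<inter> Q' = {} \<and> F' \<inter> P' \<noteq> {} \<and> F' \<inter> Q' \<noteq> {}"
proof -
  \<comment> \<open>The witnesses will be \<open>{x, y}\<close>, \<open>{x, u}\<close> and
    \<open>{y, w}\<close>: \<open>u\<close> avoids \<open>y\<close>, and \<open>w\<close> avoids
    \<open>x\<close> and \<open>u\<close>, so that the pairs for p and q are disjoint.\<close>
  have "card {x, y} < card P"
    using assms by simp
  then obtain u where u: "u \<in> P" "u \<noteq> x" "u \<noteq> y"
    by (rule obtain_in_Diff) auto
  then have "card {x, y, u} < card Q"
    using assms by simp
  then obtain w where "w \<in> Q" "w \<noteq> x" "w \<noteq> y" "w \<noteq> u"
    by (rule obtain_in_Diff) auto
  with u assms show ?thesis
    by (intro exI[of _ "{x, y}"] exI[of _ "{x, u}"] exI[of _ "{y, w}"]) auto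
qed

text \<open>Giving \<open>y\<close> to both f and q settles the cycle edges at q. For
  \<open>X\<close> among \<open>A\<close>, \<open>B\<close>, either the pair for p escapes
  \<open>X\<close>, or \<open>X\<close> holds at least 4 colors outside \<open>F\<close>, hence at
  most 3 of \<open>F\<close>, and the pair for f can escape it.\<close>

lemma spokes_one_shared_color:
  assumes "card F = 7" "5 \<le> card P" "5 \<le> card Q" "card A = 7" "card B = 7"
    and y: "y \<in> F" "y \<in> Q" and disj: "(P - {y}) \<inter> F = {}"
  shows "\<exists>F' P' Q'. F' \<subseteq> F \<and> P' \<subseteq> P \<and> Q' \<subseteq> Q \<and> card F' = 2 \<and> card P' = 2 \<and> card Q' = 2 \<and>
           P' \<inter> Q' = {} \<and> (\<not> F' \<subseteq> A \<or> \<not> P' \<subseteq> A) \<and> (\<not> F' \<subseteq> B \<or> \<not> P' \<subseteq> B) \<and> F' \<inter> Q' \<noteq> {}"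
proof -
  have S: "4 \<le> card (P - {y})"
    using assms by (intro card_Diff_ge) auto
  then obtain P' where P': "P' \<subseteq> P - {y}" "card P' = 2"
    "P - {y} \<subseteq> A \<or> \<not> P' \<subseteq> A" "P - {y} \<subseteq> B \<or> \<not> P' \<subseteq> B"
    using obtain_pair_avoiding[of "P - {y}" A B] by auto
  \<comment> \<open>\<open>bad X\<close> collects the second colors \<open>z\<close> for which
    \<open>{y, z}\<close> would lie inside an \<open>X\<close> that \<open>P'\<close> cannot escape.
    If it is nonempty, \<open>y\<close> is one of the at most 3 colors of \<open>X\<close> in
    \<open>F\<close>. So at most 2 + 2 + 1 of the 7 colors of \<open>F\<close> are excluded for
    \<open>z\<close>.\<close>
  define bad where "bad X = (if P - {y} \<subseteq> X \<and> y \<in> X then X \<inter> F - {y} else {})" for X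
  have bad: "card (bad X) \<le> 2 \<and> finite (bad X)" if "card X = 7" for X
  proof (cases "P - {y} \<subseteq> X \<and> y \<in> X")
    case True
    have "finite X"
      using that by (auto intro: card_ge_finite)
    then have "card (X \<inter> F) \<le> 3"
      using card_Int_le_of_subset[of X "P - {y}" F] True disj S that by auto
    then show ?thesis
      using True y \<open>finite X\<close> by (simp add: bad_def)
  qed (auto simp: bad_def)
  have "card (bad A \<union> bad B \<union> {y}) \<le> 5"
    using bad[of A] bad[of B] assms card_Un_le[of "bad A \<union> bad B" "{y}"]
      card_Un_le[of "bad A" "bad B"] by simp
  then have "card (bad A \<union> bad B \<union> {y}) < card F"
    using assms by simp
  then obtain z where z: "z \<in> F" "z \<notin> bad A" "z \<notin> bad B" "z \<noteq> y"
    by (rule obtain_in_Diff) (use bad[of A] bad[of B] assms in auto)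
  have "finite P'"
    using P' by (auto intro: card_ge_finite)
  then have "card (insert y P') < card Q"
    using assms P' by (auto simp: card_insert_if)
  then obtain w where w: "w \<in> Q" "w \<notin> P'" "w \<noteq> y"
    by (rule obtain_in_Diff) (use \<open>finite P'\<close> in auto)
  have "\<not> {y, z} \<subseteq> X \<or> \<not> P' \<subseteq> X" if "z \<notin> bad X" "P - {y} \<subseteq> X \<or> \<not> P' \<subseteq> X" for X
    using that z(1,4) by (auto simp: bad_def)
  then have "\<not> {y, z} \<subseteq> A \<or> \<not> P' \<subseteq> A" "\<not> {y, z} \<subseteq> B \<or> \<not> P' \<subseteq> B"
    using z P' by blast+
  moreover have "{y, z} \<subseteq> F" "card {y, z} = 2" "P' \<subseteq> P" "{y, w} \<subseteq> Q" "card {y, w} = 2"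
    "P' \<inter> {y, w} = {}" "{y, z} \<inter> {y, w} \<noteq> {}"
    using P' z w y by auto
  ultimately show ?thesis
    using P'(2) by (intro exI[of _ "{y, z}"] exI[of _ P'] exI[of _ "{y, w}"] conjI)
qed

text \<open>No color can be shared with f here, so every cycle list has to miss a color of the
  chosen pairs. The pairs for p and q escape the lists where possible; a list that they cannot
  escape contains many colors outside \<open>F\<close>, and the pair for f escapes it.\<close>

lemma spokes_disjoint:
  assumes "card F = 7" "5 \<le> card P" "5 \<le> card Q"
    and "card A = 7" "card B = 7" "card C = 7" "card D = 7"
    and disj: "P \<inter> F = {}" "Q \<inter> F = {}"
  shows "\<exists>F' P' Q'. F' \<subseteq> F \<and> P' \<subseteq> P \<and> Q' \<subseteq> Q \<and> card F' = 2 \<and> card P' = 2 \<and> card Q' = 2 \<and>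
           P' \<inter> Q' = {} \<and> (\<not> F' \<subseteq> A \<or> \<not> P' \<subseteq> A) \<and> (\<not> F' \<subseteq> B \<or> \<not> P' \<subseteq> B) \<and>
           (\<not> F' \<subseteq> C \<or> \<not> Q' \<subseteq> C) \<and> (\<not> F' \<subseteq> D \<or> \<not> Q' \<subseteq> D)"
proof -
  obtain P' where P': "P' \<subseteq> P" "card P' = 2" "P \<subseteq> A \<or> \<not> P' \<subseteq> A" "P \<subseteq> B \<or> \<not> P' \<subseteq> B"
    using obtain_pair_avoiding[of P A B] assms by auto
  have S: "3 \<le> card (Q - P')"
    using assms P' by (intro card_Diff_ge) (auto intro: card_ge_finite)
  then obtain Q' where Q': "Q' \<subseteq> Q - P'" "card Q' = 2"
    "Q - P' \<subseteq> C \<or> \<not> Q' \<subseteq> C" "Q - P' \<subseteq> D \<or> \<not> Q' \<subseteq> D"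
    using obtain_pair_avoiding[of "Q - P'" C D] by auto
  \<comment> \<open>If \<open>X\<close> contains \<open>S\<close>, no pair from \<open>S\<close>
    escapes it, so \<open>F'\<close> has to escape the trace of \<open>X\<close> on
    \<open>F\<close>. The set \<open>S\<close> uses up at least \<open>n\<close> of the 7 colors of
    \<open>X\<close>, which leaves at most \<open>7 - n\<close> for this trace.\<close>
  define bad where "bad S X = (if S \<subseteq> X then X \<inter> F else {})" for S X
  have bad: "card (bad S X) \<le> 7 - n \<and> finite (bad S X)"
    if "card X = 7" "n \<le> card S" "S \<inter> F = {}" for X S n
  proof (cases "S \<subseteq> X")
    case True
    have "finite X"
      using that by (auto intro: card_ge_finite)
    then have "card (X \<inter> F) \<le> 7 - card S"
      using card_Int_le_of_subset[of X S F] True that by auto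
    then show ?thesis
      using True that \<open>finite X\<close> by (simp add: bad_def)
  qed (auto simp: bad_def)
  \<comment> \<open>\<open>P\<close> has at least 5 colors and \<open>Q - P'\<close> at least 3, so
    the two traces have at most 2 and 4 colors, fewer than 7 together.\<close>
  have not_covered: "\<not> F \<subseteq> bad P X \<union> bad (Q - P') Y" if "card X = 7" "card Y = 7" for X Y
  proof
    assume "F \<subseteq> bad P X \<union> bad (Q - P') Y"
    have b: "card (bad P X) \<le> 7 - 5 \<and> finite (bad P X)"
      "card (bad (Q - P') Y) \<le> 7 - 3 \<and> finite (bad (Q - P') Y)"
      using that assms S by (intro bad; auto)+
    then have "card F \<le> card (bad P X \<union> bad (Q - P') Y)"
      using \<open>F \<subseteq> _\<close> by (intro card_mono) auto
    with b card_Un_le[of "bad P X" "bad (Q - P') Y"] assms show False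
      by simp
  qed
  \<comment> \<open>A pair escapes two sets, so the four obstacles are merged into two unions, each
    with one obstacle from p and one from q. Merging \<open>C\<close> with \<open>D\<close> would
    only give the bound 4 + 4, which exceeds 7.\<close>
  obtain F' where F': "F' \<subseteq> F" "card F' = 2"
    "\<not> F' \<subseteq> bad P A \<union> bad (Q - P') C" "\<not> F' \<subseteq> bad P B \<union> bad (Q - P') D"
    using obtain_pair_avoiding[of F "bad P A \<union> bad (Q - P') C" "bad P B \<union> bad (Q - P') D"]
      not_covered assms by auto
  have "\<not> F' \<subseteq> bad P A" "\<not> F' \<subseteq> bad P B" "\<not> F' \<subseteq> bad (Q - P') C" "\<not> F' \<subseteq> bad (Q - P') D"
    using F' by blast+
  then have "P \<subseteq> A \<longrightarrow> \<not> F' \<subseteq> A" "P \<subseteq> B \<longrightarrow> \<not> F' \<subseteq> B"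
    "Q - P' \<subseteq> C \<longrightarrow> \<not> F' \<subseteq> C" "Q - P' \<subseteq> D \<longrightarrow> \<not> F' \<subseteq> D"
    using F'(1) by (auto simp: bad_def)
  then have "\<not> F' \<subseteq> A \<or> \<not> P' \<subseteq> A" "\<not> F' \<subseteq> B \<or> \<not> P' \<subseteq> B"
    "\<not> F' \<subseteq> C \<or> \<not> Q' \<subseteq> C" "\<not> F' \<subseteq> D \<or> \<not> Q' \<subseteq> D"
    using P'(3,4) Q'(3,4) by blast+
  moreover have "Q' \<subseteq> Q" "P' \<inter> Q' = {}"
    using Q'(1) by blast+
  ultimately show ?thesis
    using F'(1,2) P'(1,2) Q'(2) by (intro exI[of _ F'] exI[of _ P'] exI[of _ Q'] conjI)
qed

lemma spokes_choosable:
  assumes "card F = 7" "5 \<le> card P" "5 \<le> card Q"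
    and "card A = 7" "card B = 7" "card C = 7" "card D = 7"
  obtains F' P' Q' where "F' \<subseteq> F" "P' \<subseteq> P" "Q' \<subseteq> Q"
    "card F' = 2" "card P' = 2" "card Q' = 2" "P' \<inter> Q' = {}"
    "4 \<le> card (A - (F' \<union> P'))" "4 \<le> card (B - (F' \<union> P'))"
    "4 \<le> card (C - (F' \<union> Q'))" "4 \<le> card (D - (F' \<union> Q'))"
proof -
  have "\<exists>F' P' Q'. F' \<subseteq> F \<and> P' \<subseteq> P \<and> Q' \<subseteq> Q \<and> card F' = 2 \<and> card P' = 2 \<and> card Q' = 2 \<and>
     P' \<inter> Q' = {} \<and>
     (F' \<inter> P' \<noteq> {} \<or> \<not> F' \<subseteq> A \<or> \<not> P' \<subseteq> A) \<and> (F' \<inter> P' \<noteq> {} \<or> \<not> F' \<subseteq> B \<or> \<not> P' \<subseteq> B) \<and>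
     (F' \<inter> Q' \<noteq> {} \<or> \<not> F' \<subseteq> C \<or> \<not> Q' \<subseteq> C) \<and> (F' \<inter> Q' \<noteq> {} \<or> \<not> F' \<subseteq> D \<or> \<not> Q' \<subseteq> D)"
  proof -
    \<comment> \<open>Unless \<open>two\<close> holds, a color \<open>y\<close> in both
      \<open>F\<close> and \<open>Q\<close> is the only one that \<open>F\<close> can share with
      \<open>P\<close>, which is case \<open>q\<close>. If \<open>F\<close> and \<open>Q\<close> are
      disjoint, \<open>p\<close> or \<open>none\<close> applies, since \<open>Q - {y}\<close> then
      misses \<open>F\<close> for every \<open>y\<close>.\<close>
    consider (two) x y where "x \<in> F" "x \<in> P" "y \<in> F" "y \<in> Q" "x \<noteq> y"
      | (q) y where "y \<in> F" "y \<in> Q" "(P - {y}) \<inter> F = {}"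
      | (p) y where "y \<in> F" "y \<in> P" "(Q - {y}) \<inter> F = {}"
      | (none) "P \<inter> F = {}" "Q \<inter> F = {}"
      by blast
    then show ?thesis
    proof cases
      case two
      from spokes_two_shared_colors[OF this assms(2,3)] show ?thesis
        by (elim ex_forward) simp
    next
      case q
      from spokes_one_shared_color[OF assms(1-5) this] show ?thesis
        by (elim ex_forward) simp
    next
      case p
      \<comment> \<open>The roles of p and q are exchanged, hence also those of \<open>A\<close>,
        \<open>B\<close> and \<open>C\<close>, \<open>D\<close>.\<close>
      from spokes_one_shared_color[OF assms(1,3,2,6,7) this] obtain F' P' Q' where
        "F' \<subseteq> F \<and> Q' \<subseteq> Q \<and> P' \<subseteq> P \<and> card F' = 2 \<and> card Q' = 2 \<and> card P' = 2 \<and>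
         Q' \<inter> P' = {} \<and> (\<not> F' \<subseteq> C \<or> \<not> Q' \<subseteq> C) \<and> (\<not> F' \<subseteq> D \<or> \<not> Q' \<subseteq> D) \<and> F' \<inter> P' \<noteq> {}"
        by blast
      then show ?thesis
        by (intro exI[of _ F'] exI[of _ P'] exI[of _ Q']) (simp add: Int_commute)
    next
      case none
      from spokes_disjoint[OF assms this] show ?thesis
        by (elim ex_forward) simp
    qed
  qed
  then obtain F' P' Q' where "F' \<subseteq> F" "P' \<subseteq> P" "Q' \<subseteq> Q"
    "card F' = 2" "card P' = 2" "card Q' = 2" "P' \<inter> Q' = {}"
    "F' \<inter> P' \<noteq> {} \<or> \<not> F' \<subseteq> A \<or> \<not> P' \<subseteq> A" "F' \<inter> P' \<noteq> {} \<or> \<not> F' \<subseteq> B \<or> \<not> P' \<subseteq> B"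
    "F' \<inter> Q' \<noteq> {} \<or> \<not> F' \<subseteq> C \<or> \<not> Q' \<subseteq> C" "F' \<inter> Q' \<noteq> {} \<or> \<not> F' \<subseteq> D \<or> \<not> Q' \<subseteq> D"
    by (elim exE conjE) (rule that)
  then show ?thesis
    using assms by (intro that card_Diff_two_pairs_ge)
qed

section \<open>Coloring one copy of \<open>H\<close> and assembling \<open>Gstar\<close>\<close>

text \<open>The bound 5 for edges at the vertex \<open>4\<close> is what remains of 7 colors once
  the edge to v has taken two.\<close>

lemma H_choosable:
  fixes L :: "nat set \<Rightarrow> 'c set"
  assumes "\<And>e. e \<in> edges H \<Longrightarrow> 4 \<notin> e \<Longrightarrow> card (L e) = 7"
    and "\<And>e. e \<in> edges H \<Longrightarrow> 4 \<in> e \<Longrightarrow> 5 \<le> card (L e)"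
  shows "\<exists>\<psi>. (\<forall>e\<in>edges H. \<psi> e \<subseteq> L e \<and> card (\<psi> e) = 2) \<and>
           (\<forall>e\<in>edges H. \<forall>f\<in>edges H. e \<noteq> f \<and> e \<inter> f \<noteq> {} \<longrightarrow> \<psi> e \<inter> \<psi> f = {})"
proof -
  \<comment> \<open>Here f is \<open>{2, 3}\<close>, while p and q are \<open>{0, 4}\<close> and
    \<open>{1, 4}\<close>. The other four edges form the cycle 0-2-1-3, in which
    \<open>{0, 2}\<close> is opposite to \<open>{1, 3}\<close>.\<close>
  have "card (L {2, 3}) = 7" "5 \<le> card (L {0, 4})" "5 \<le> card (L {1, 4})"
    "card (L {0, 2}) = 7" "card (L {0, 3}) = 7" "card (L {1, 2}) = 7" "card (L {1, 3}) = 7"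
    using assms by (simp_all add: edges_H)
  then obtain F P Q where FPQ: "F \<subseteq> L {2, 3}" "P \<subseteq> L {0, 4}" "Q \<subseteq> L {1, 4}"
    "card F = 2" "card P = 2" "card Q = 2" "P \<inter> Q = {}" and
    rest: "2 * 2 \<le> card (L {0, 2} - (F \<union> P))" "2 * 2 \<le> card (L {0, 3} - (F \<union> P))"
    "2 * 2 \<le> card (L {1, 2} - (F \<union> Q))" "2 * 2 \<le> card (L {1, 3} - (F \<union> Q))"
    using spokes_choosable[of "L {2, 3}" "L {0, 4}" "L {1, 4}" "L {0, 2}" "L {0, 3}" "L {1, 2}"
      "L {1, 3}"] by auto
  obtain A B C D where ABCD: "A \<subseteq> L {0, 2} - (F \<union> P)" "B \<subseteq> L {0, 3} - (F \<union> P)"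
    "C \<subseteq> L {1, 2} - (F \<union> Q)" "D \<subseteq> L {1, 3} - (F \<union> Q)"
    "card A = 2" "card B = 2" "card C = 2" "card D = 2"
    "A \<inter> B = {}" "A \<inter> C = {}" "B \<inter> D = {}" "C \<inter> D = {}"
    using four_cycle_choosable[OF rest] .
  define \<psi> where "\<psi> = (\<lambda>_. {})({0, 2} := A, {0, 3} := B, {1, 2} := C, {1, 3} := D,
    {2, 3} := F, {0, 4} := P, {1, 4::nat} := Q)"
  have \<psi>: "\<psi> {0, 2} = A" "\<psi> {0, 3} = B" "\<psi> {1, 2} = C" "\<psi> {1, 3} = D"
    "\<psi> {2, 3} = F" "\<psi> {0, 4} = P" "\<psi> {1, 4} = Q"
    by (simp_all add: \<psi>_def doubleton_eq_iff)
  have disj: "A \<inter> F = {}" "B \<inter> F = {}" "C \<inter> F = {}" "D \<inter> F = {}"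
    "A \<inter> P = {}" "B \<inter> P = {}" "C \<inter> Q = {}" "D \<inter> Q = {}"
    using ABCD(1-4) by blast+
  have "\<forall>e\<in>edges H. \<psi> e \<subseteq> L e \<and> card (\<psi> e) = 2"
    using FPQ ABCD by (auto simp: edges_H \<psi> simp del: One_nat_def)
  moreover have "\<forall>e\<in>edges H. \<forall>f\<in>edges H. e \<noteq> f \<and> e \<inter> f \<noteq> {} \<longrightarrow> \<psi> e \<inter> \<psi> f = {}"
    using FPQ(7) ABCD(9-12) disj by (simp add: edges_H \<psi> Int_commute del: One_nat_def)
  ultimately show ?thesis
    by blast
qed

text \<open>Greedy choice: the third list loses at most 4 colors to the first two pairs, so 6 colors
  suffice.\<close>

lemma three_disjoint_pairs:
  fixes L :: "nat \<Rightarrow> 'c set"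
  assumes "\<And>i. i < 3 \<Longrightarrow> 6 \<le> card (L i)"
  shows "\<exists>A. (\<forall>i<3. A i \<subseteq> L i \<and> card (A i) = 2) \<and>
           (\<forall>i<3. \<forall>j<3. i \<noteq> j \<longrightarrow> A i \<inter> A j = {})"
proof -
  obtain X where X: "X \<subseteq> L 0" "card X = 2" "finite X"
    using obtain_subset_card_ge[of 2 "L 0"] assms[of 0] by auto
  have "2 \<le> card (L 1 - X)"
    using X assms[of 1] by (intro card_Diff_ge) auto
  then obtain Y where Y: "Y \<subseteq> L 1 - X" "card Y = 2" "finite Y"
    by (rule obtain_subset_card_ge)
  have "2 \<le> card (L 2 - (X \<union> Y))"
    using X Y assms[of 2] card_Un_le[of X Y] by (intro card_Diff_ge) auto
  then obtain Z where Z: "Z \<subseteq> L 2 - (X \<union> Y)" "card Z = 2"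
    by (rule obtain_subset_card_ge)
  have less_3: "i < 3 \<longleftrightarrow> i = 0 \<or> i = 1 \<or> i = 2" for i :: nat
    by auto
  define A :: "nat \<Rightarrow> 'c set" where "A = (\<lambda>_. {})(0 := X, 1 := Y, 2 := Z)"
  have "A 0 = X" "A 1 = Y" "A 2 = Z"
    by (simp_all add: A_def)
  with X Y Z show ?thesis
    by (intro exI[of _ A]) (auto simp: less_3)
qed

lemma edges_Gstar:
  "edges Gstar = {(\<lambda>x. Some (i, x)) ` e | i e. i < 3 \<and> e \<in> edges H} \<union>
     {{None, Some (i, 4)} | i. i < 3}"
proof -
  have "{{None, Some (i, x)} | i x. i < (3::nat) \<and> x \<in> verts H \<and> degree H x = 2} =
      {{None, Some (i, 4)} | i. i < 3}"
    using degree_H_eq_2_iff verts_H by auto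
  then show ?thesis
    by (simp add: Gstar_def)
qed

theorem theorem3: "edge_choosable TYPE('c) 7 2 Gstar"
  unfolding edge_choosable_def
proof (intro allI impI)
  fix L :: "(nat \<times> nat) option set \<Rightarrow> 'c set"
  assume L: "\<forall>e\<in>edges Gstar. finite (L e) \<and> card (L e) = 7"
  define emb where "emb i e = (\<lambda>x. Some (i, x)) ` e" for i :: nat and e :: "nat set"
  have L_emb: "card (L (emb i e)) = 7" if "i < 3" "e \<in> edges H" for i e
  proof -
    have "emb i e \<in> edges Gstar"
      using that unfolding edges_Gstar emb_def by blast
    with L show ?thesis
      by simp
  qed
  have L_v: "card (L {None, Some (i, 4)}) = 7" if "i < 3" for i
  proof -
    have "{None, Some (i, 4)} \<in> edges Gstar"
      using that unfolding edges_Gstar by blast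
    with L show ?thesis
      by simp
  qed
  have "\<exists>A. (\<forall>i<3. A i \<subseteq> L {None, Some (i, 4)} \<and> card (A i) = 2) \<and>
      (\<forall>i<3. \<forall>j<3. i \<noteq> j \<longrightarrow> A i \<inter> A j = {})"
    by (rule three_disjoint_pairs) (simp add: L_v)
  then obtain A where A: "\<And>i. i < 3 \<Longrightarrow> A i \<subseteq> L {None, Some (i, 4)}" "\<And>i. i < 3 \<Longrightarrow> card (A i) = 2"
    "\<And>i j. i < 3 \<Longrightarrow> j < 3 \<Longrightarrow> i \<noteq> j \<Longrightarrow> A i \<inter> A j = {}"
    by metis
  \<comment> \<open>Within a copy, only the edges at the vertex \<open>4\<close> meet the edge to v,
    so only they lose the colors \<open>A i\<close>.\<close>
  define L' where "L' i e = (if 4 \<in> e then L (emb i e) - A i else L (emb i e))" for i e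
  have "\<exists>\<psi>. (\<forall>e\<in>edges H. \<psi> e \<subseteq> L' i e \<and> card (\<psi> e) = 2) \<and>
      (\<forall>e\<in>edges H. \<forall>f\<in>edges H. e \<noteq> f \<and> e \<inter> f \<noteq> {} \<longrightarrow> \<psi> e \<inter> \<psi> f = {})" if "i < 3" for i
  proof (rule H_choosable)
    have "finite (A i)"
      using A(2)[OF that] by (auto intro: card_ge_finite)
    then show "5 \<le> card (L' i e)" if "e \<in> edges H" "4 \<in> e" for e
      using that L_emb[OF \<open>i < 3\<close>] A(2)[OF \<open>i < 3\<close>] by (auto simp: L'_def intro!: card_Diff_ge)
  qed (simp add: L'_def L_emb that)
  then obtain \<psi> where
    \<psi>: "\<And>i e. i < 3 \<Longrightarrow> e \<in> edges H \<Longrightarrow> \<psi> i e \<subseteq> L' i e \<and> card (\<psi> i e) = 2" and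
    \<psi>_disj: "\<And>i e f. i < 3 \<Longrightarrow> e \<in> edges H \<Longrightarrow> f \<in> edges H \<Longrightarrow> e \<noteq> f \<Longrightarrow> e \<inter> f \<noteq> {} \<Longrightarrow>
      \<psi> i e \<inter> \<psi> i f = {}"
    by metis
  \<comment> \<open>Each edge of \<open>Gstar\<close> has its vertices other than
    \<open>None\<close> in exactly one copy, so the description is unique on edges.\<close>
  define index where "index e = (THE i. \<exists>x. Some (i, x) \<in> e)"
    for e :: "(nat \<times> nat) option set"
  define \<phi> where "\<phi> e = (if None \<in> e then A (index e) else \<psi> (index e) {x. Some (index e, x) \<in> e})"
    for e
  have ne: "e \<noteq> {}" if "e \<in> edges H" for e
    using that by (auto simp: edges_H)
  have \<phi>_emb: "\<phi> (emb i e) = \<psi> i e" if "e \<in> edges H" for i e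
  proof -
    have "index (emb i e) = i"
      using ne[OF that] by (auto simp: index_def emb_def)
    moreover have "{x. Some (i, x) \<in> emb i e} = e" "None \<notin> emb i e"
      by (auto simp: emb_def)
    ultimately show ?thesis
      by (simp add: \<phi>_def)
  qed
  have \<phi>_v: "\<phi> {None, Some (i, 4)} = A i" for i
    by (simp add: \<phi>_def index_def)
  have cases: thesis if "g \<in> edges Gstar"
    "\<And>i e. i < 3 \<Longrightarrow> e \<in> edges H \<Longrightarrow> g = emb i e \<Longrightarrow> thesis"
    "\<And>i. i < 3 \<Longrightarrow> g = {None, Some (i, 4)} \<Longrightarrow> thesis" for g thesis
    using that unfolding edges_Gstar emb_def by blast
  \<comment> \<open>The two edges can only meet in \<open>Some (j, 4)\<close>. This forces
    \<open>i = j\<close> and \<open>4 \<in> e\<close>, and then \<open>A j\<close> was removed from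
    \<open>L' i e\<close>.\<close>
  have mixed: "\<psi> i e \<inter> A j = {}"
    if "i < 3" "e \<in> edges H" "emb i e \<inter> {None, Some (j, 4)} \<noteq> {}" for i j e
    using that \<psi>[of i e] by (auto simp: emb_def L'_def)
  have "\<phi> g \<subseteq> L g \<and> card (\<phi> g) = 2" if "g \<in> edges Gstar" for g
    using that
  proof (rule cases)
    fix i e assume "i < 3" "e \<in> edges H" "g = emb i e"
    with \<psi>[of i e] show ?thesis
      by (auto simp: \<phi>_emb L'_def split: if_splits)
  qed (use A in \<open>simp add: \<phi>_v\<close>)
  moreover have "\<phi> g \<inter> \<phi> h = {}"
    if g: "g \<in> edges Gstar" and h: "h \<in> edges Gstar" and gh: "g \<noteq> h" "g \<inter> h \<noteq> {}" for g h
    using g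
  proof (rule cases)
    fix i e assume i: "i < 3" "e \<in> edges H" "g = emb i e"
    from h show ?thesis
    proof (rule cases)
      fix j f assume j: "j < 3" "f \<in> edges H" "h = emb j f"
      with i gh have "i = j" "e \<noteq> f" "e \<inter> f \<noteq> {}"
        by (auto simp: emb_def)
      with i j \<psi>_disj show ?thesis
        by (simp add: \<phi>_emb)
    next
      fix j assume "j < 3" "h = {None, Some (j, 4)}"
      with i gh mixed show ?thesis
        by (simp add: \<phi>_emb \<phi>_v)
    qed
  next
    fix i assume i: "i < 3" "g = {None, Some (i, 4)}"
    from h show ?thesis
    proof (rule cases)
      fix j f assume "j < 3" "f \<in> edges H" "h = emb j f"
      with i gh mixed[of j f i] show ?thesis
        by (simp add: \<phi>_emb \<phi>_v Int_commute)
    next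
      fix j assume "j < 3" "h = {None, Some (j, 4)}"
      with i gh A(3)[of i j] show ?thesis
        by (cases "i = j") (simp_all add: \<phi>_v)
    qed
  qed
  ultimately show "\<exists>\<phi>. (\<forall>e\<in>edges Gstar. \<phi> e \<subseteq> L e \<and> card (\<phi> e) = 2) \<and>
      (\<forall>e\<in>edges Gstar. \<forall>f\<in>edges Gstar. e \<noteq> f \<and> e \<inter> f \<noteq> {} \<longrightarrow> \<phi> e \<inter> \<phi> f = {})"
    by blast
qed

end
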